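(* Let $U$ and $V=(FU)^+FM$ be the matrices output by the algorithm described in the context applied to a matrix $M\in\mathbb R^{m\times n}$ with multipliers $F\in\mathbb R^{k\times m}$ and $H\in\mathbb R^{n\times l}$, and suppose that $m\ge k\ge l=\operatorname{rank}(U)$. Then $$M-UV=\big(I_m-U(FU)^+F\big)\big(M-UU^+M\big)$$ and hence $$|M-UV|\le f\,|M-UU^+M|\quad\text{for}\quad f:=|I_m-U(FU)^+F|\le1+|U|\,|(FU)^+|\,|F| .$$
   Context: $|\cdot|$ denotes the spectral or the Frobenius matrix norm; $X^+$ is the Moore–Penrose pseudo inverse; $X_r$ is the rank-$r$ truncation of $X$; $\mathcal R(X)$ is the column span. The numerical rank of a matrix is the minimal rank of a matrix within a small relative norm distance from it (so it does not exceed the rank). Algorithm: given $M\in\mathbb R^{m\times n}$, a target rank $r$, integers $k,l$ with $r\le k\le m$, $r\le l\le n$, and matrices $F\in\mathbb R^{k\times m}$, $H\in\mathbb R^{n\times l}$ of full numerical ranks $k$ and $l$: compute $MH$ and output FAILURE if its numerical rank is less than $r$; otherwise compute an $m\times l$ matrix $U$ of rank $r$ such that $\mathcal R(MH)\supseteq\mathcal R(U)\supseteq\mathcal R((MH)_r)$; compute $FU$ and $FM$; output FAILURE if the numerical rank of $FU$ is less than $r$; otherwise output $U$ and $V:=(FU)^+FM$. It is assumed that no FAILURE occurs, so that in particular $\operatorname{rank}(FU)\ge r=\operatorname{rank}(U)$.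
   Formalization: The bound f ≤ 1+|U||(FU)^+||F| is proved for the spectral norm; it fails for the Frobenius norm since |I_m|_F=√m, so there 1 is replaced by |I_m|_F, and |M-UV|_F ≤ f_2|M-UU^+M|_F with spectral f_2 ≤ 1+|U|_F|(FU)^+|_F|F|_F is added. *)

theory Defs
  imports "HOL-Analysis.Analysis"
begin

datatype mat_norm_kind = Spectral | Frobenius

text \<open>
  The library norm on \<open>real^'n^'m\<close> is the Euclidean norm of the family of all entries,
  that is, the Frobenius norm; it is not the operator norm.
\<close>

primrec mnorm :: "mat_norm_kind \<Rightarrow> real^'n^'m \<Rightarrow> real" where
  "mnorm Spectral A = onorm (\<lambda>x. A *v x)"
| "mnorm Frobenius A = norm A"

text \<open>The four Penrose conditions.\<close>

definition is_pinv :: "real^'n^'m \<Rightarrow> real^'m^'n \<Rightarrow> bool" where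
  "is_pinv A X \<longleftrightarrow>
     A ** X ** A = A \<and>
     X ** A ** X = X \<and>
     transpose (A ** X) = A ** X \<and>
     transpose (X ** A) = X ** A"

definition pinv :: "real^'n^'m \<Rightarrow> real^'m^'n" where
  "pinv A = (THE X. is_pinv A X)"

definition col_span :: "real^'n^'m \<Rightarrow> (real^'m) set" where
  "col_span A = span (columns A)"

definition outer :: "real^'m \<Rightarrow> real^'n \<Rightarrow> real^'n^'m" where
  "outer a b = (\<chi> i j. a $ i * b $ j)"

definition orthonormal_upto :: "nat \<Rightarrow> (nat \<Rightarrow> 'a::real_inner) \<Rightarrow> bool" where
  "orthonormal_upto p s \<longleftrightarrow> (\<forall>i<p. \<forall>j<p. s i \<bullet> s j = (if i = j then 1 else 0))"

text \<open>
  \<open>is_compact_svd X p \<sigma> s t\<close>: the matrix \<open>X\<close> has the compact singular value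
  decomposition with \<open>p\<close> positive, nonincreasing singular values \<open>\<sigma> 0, \<dots>, \<sigma> (p - 1)\<close>
  and left and right singular vectors \<open>s i\<close> and \<open>t i\<close> (so \<open>p\<close> is the rank of \<open>X\<close>).
\<close>

definition is_compact_svd ::
  "real^'n^'m \<Rightarrow> nat \<Rightarrow> (nat \<Rightarrow> real) \<Rightarrow> (nat \<Rightarrow> real^'m) \<Rightarrow> (nat \<Rightarrow> real^'n) \<Rightarrow> bool" where
  "is_compact_svd X p \<sigma> s t \<longleftrightarrow>
     (\<forall>i<p. 0 < \<sigma> i) \<and>
     (\<forall>i j. i \<le> j \<and> j < p \<longrightarrow> \<sigma> j \<le> \<sigma> i) \<and>
     orthonormal_upto p s \<and>
     orthonormal_upto p t \<and>
     X = (\<Sum>i<p. \<sigma> i *\<^sub>R outer (s i) (t i))"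

text \<open>
  The rank-\<open>r\<close> truncation keeps the \<open>r\<close> largest singular values.  It is a relation because
  the truncation depends on the decomposition chosen when the singular values numbered
  \<open>r\<close> and \<open>r + 1\<close> coincide.
\<close>

definition is_truncation :: "nat \<Rightarrow> real^'n^'m \<Rightarrow> real^'n^'m \<Rightarrow> bool" where
  "is_truncation r X Y \<longleftrightarrow>
     (\<exists>p \<sigma> s t. is_compact_svd X p \<sigma> s t \<and>
        Y = (\<Sum>i<min r p. \<sigma> i *\<^sub>R outer (s i) (t i)))"

text \<open>
  Numerical rank with respect to a relative tolerance \<open>\<epsilon>\<close> in the norm \<open>\<kappa>\<close>.  For \<open>\<epsilon> \<ge> 0\<close>
  the matrix itself is an admissible competitor, so the numerical rank is at most the rank.
\<close>

definition num_rank :: "mat_norm_kind \<Rightarrow> real \<Rightarrow> real^'n^'m \<Rightarrow> nat" where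
  "num_rank \<kappa> \<epsilon> A = (LEAST d. \<exists>B. mnorm \<kappa> (A - B) \<le> \<epsilon> * mnorm \<kappa> A \<and> rank B = d)"

text \<open>
  \<open>lra_output \<kappa> \<epsilon> r M F H U V\<close>: on an admissible input \<open>M\<close>, \<open>r\<close>, \<open>F\<close>, \<open>H\<close>, with numerical
  ranks taken with respect to \<open>\<kappa>\<close> and \<open>\<epsilon>\<close>, the algorithm may terminate without FAILURE and
  output \<open>U\<close> and \<open>V\<close>.  The algorithm leaves the choice of \<open>U\<close> open, hence a relation.
\<close>

definition lra_output ::
  "mat_norm_kind \<Rightarrow> real \<Rightarrow> nat \<Rightarrow> real^'n^'m \<Rightarrow> real^'m^'k \<Rightarrow> real^'l^'n
     \<Rightarrow> real^'l^'m \<Rightarrow> real^'n^'l \<Rightarrow> bool" where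
  "lra_output \<kappa> \<epsilon> r M F H U V \<longleftrightarrow>
     r \<le> CARD('k) \<and> CARD('k) \<le> CARD('m) \<and>
     r \<le> CARD('l) \<and> CARD('l) \<le> CARD('n) \<and>
     num_rank \<kappa> \<epsilon> F = CARD('k) \<and>
     num_rank \<kappa> \<epsilon> H = CARD('l) \<and>
     r \<le> num_rank \<kappa> \<epsilon> (M ** H) \<and>
     rank U = r \<and>
     col_span U \<subseteq> col_span (M ** H) \<and>
     (\<exists>T. is_truncation r (M ** H) T \<and> col_span T \<subseteq> col_span U) \<and>
     r \<le> num_rank \<kappa> \<epsilon> (F ** U) \<and>
     V = pinv (F ** U) ** (F ** M)"

end

theory Submission
  imports Defs
begin

text \<open>
  Since no FAILURE occurs, \<open>F ** U\<close> has full column rank, so its pseudo inverse is a left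
  inverse and \<open>P = I - U (F U)\<^sup>+ F\<close> annihilates \<open>U\<close>. Hence \<open>P\<close> maps \<open>M\<close> and \<open>M - U X M\<close> to the
  same matrix \<open>M - U V\<close> for every \<open>X\<close>, in particular for \<open>X = U\<^sup>+\<close>.
\<close>

lemma matrix_diff_ldistrib:
  fixes A :: "real^'n^'m" and B C :: "real^'p^'n"
  shows "A ** (B - C) = A ** B - A ** C"
  by (vector matrix_matrix_mult_def sum_subtractf right_diff_distrib)

lemma matrix_diff_rdistrib:
  fixes A B :: "real^'n^'m" and C :: "real^'p^'n"
  shows "(A - B) ** C = A ** C - B ** C"
  by (vector matrix_matrix_mult_def sum_subtractf left_diff_distrib)

lemma mnorm_nonneg: "0 \<le> mnorm \<nu> A"
  by (cases \<nu>) (simp_all add: onorm_pos_le matrix_vector_mul_bounded_linear)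

text \<open>Turns the FAILURE tests, stated for the numerical rank, into lower bounds for the true
  rank.\<close>

lemma num_rank_le_rank:
  assumes "0 \<le> \<epsilon>"
  shows "num_rank \<kappa> \<epsilon> A \<le> rank A"
proof -
  have "mnorm \<kappa> (A - A) \<le> \<epsilon> * mnorm \<kappa> A"
    using assms mnorm_nonneg[of \<kappa> A] by (cases \<kappa>) (simp_all add: onorm_zero)
  then show ?thesis
    unfolding num_rank_def by (intro Least_le) blast
qed

text \<open>\<open>A ** X\<close> and \<open>A ** Y\<close> are both the orthogonal projection onto
  the range of \<open>A\<close>, so they agree; likewise \<open>X ** A\<close> and
  \<open>Y ** A\<close>. Then X = XAX = YAX = YAY = Y.\<close>

lemma is_pinv_unique:
  assumes X: "is_pinv A X" and Y: "is_pinv A Y"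
  shows "X = Y"
proof -
  \<comment> \<open>AYAX collapses to the symmetric matrix AX; transposing the product swaps the two
    symmetric factors.\<close>
  have "A ** X = transpose ((A ** Y) ** (A ** X))"
    using X Y by (simp add: is_pinv_def matrix_mul_assoc)
  also have "\<dots> = (A ** X ** A) ** Y"
    using X Y by (simp add: is_pinv_def matrix_transpose_mul) (simp add: matrix_mul_assoc)
  also have "\<dots> = A ** Y"
    using X by (simp add: is_pinv_def)
  finally have AX: "A ** X = A ** Y" .
  have "X ** A = transpose (X ** (A ** Y ** A))"
    using X Y by (simp add: is_pinv_def)
  also have "\<dots> = transpose ((X ** A) ** (Y ** A))"
    by (simp add: matrix_mul_assoc)
  also have "\<dots> = transpose (Y ** A) ** transpose (X ** A)"
    by (rule matrix_transpose_mul)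
  also have "\<dots> = Y ** (A ** X ** A)"
    using X Y by (metis is_pinv_def matrix_mul_assoc)
  also have "\<dots> = Y ** A"
    using X by (simp add: is_pinv_def)
  finally have XA: "X ** A = Y ** A" .
  have "X = (X ** A) ** X"
    using X by (simp add: is_pinv_def)
  also have "\<dots> = Y ** (A ** X)"
    by (simp add: XA matrix_mul_assoc)
  also have "\<dots> = Y"
    using Y by (simp add: AX is_pinv_def matrix_mul_assoc)
  finally show ?thesis .
qed

text \<open>The quadratic form of the Gram matrix at \<open>x\<close> is the squared length of
  \<open>A *v x\<close>, so its kernel is that of \<open>A\<close>.\<close>

lemma invertible_gram:
  fixes A :: "real^'n^'m"
  assumes "inj ((*v) A)"
  shows "invertible (transpose A ** A)"
proof -
  have "x = 0" if "(transpose A ** A) *v x = 0" for x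
  proof -
    have "(A *v x) \<bullet> (A *v x) = x \<bullet> ((transpose A ** A) *v x)"
      by (metis dot_lmul_matrix inner_commute matrix_vector_mul_assoc transpose_matrix_vector)
    then have "A *v x = A *v 0"
      using that by simp
    then show "x = 0"
      using assms by (meson injD)
  qed
  then show ?thesis
    by (metis invertible_left_inverse matrix_left_invertible_ker)
qed

text \<open>For full column rank the pseudo inverse is the inverse Gram matrix times
  \<open>transpose A\<close>.\<close>

lemma pinv_left_inverse:
  fixes A :: "real^'n^'m"
  assumes "inj ((*v) A)"
  shows "pinv A ** A = mat 1"
proof -
  define G where "G = transpose A ** A"
  obtain B where GB: "G ** B = mat 1" and BG: "B ** G = mat 1"
    using invertible_gram[OF assms] unfolding invertible_def G_def by blast
  have "transpose G = G"
    by (simp add: G_def matrix_transpose_mul)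
  then have "transpose B ** G = mat 1"
    by (metis GB matrix_transpose_mul transpose_mat)
  then have "transpose B = B"
    by (metis GB matrix_mul_assoc matrix_mul_lid matrix_mul_rid)
  define X where "X = B ** transpose A"
  have "transpose (A ** X) = A ** X"
    using \<open>transpose B = B\<close> by (simp add: X_def matrix_transpose_mul matrix_mul_assoc)
  moreover have XA: "X ** A = mat 1"
    using BG by (simp add: X_def G_def matrix_mul_assoc[symmetric])
  \<comment> \<open>Symmetry of \<open>A ** X\<close> came from that of \<open>B\<close>; the other
    three Penrose conditions follow from \<open>X ** A = mat 1\<close>.\<close>
  ultimately have "is_pinv A X"
    by (simp add: is_pinv_def matrix_mul_assoc[symmetric])
  then have "pinv A = X"
    unfolding pinv_def using is_pinv_unique by blast
  then show ?thesis
    using XA by simp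
qed

text \<open>Cauchy-Schwarz in each row, then summation of the squares.\<close>

lemma onorm_le_frobenius:
  fixes A :: "real^'n^'m"
  shows "onorm ((*v) A) \<le> norm A"
proof (rule onorm_le)
  fix x
  have "norm (A *v x) \<le> L2_set (\<lambda>i. norm (A $ i) * norm x) UNIV"
    unfolding norm_vec_def[of "A *v x"]
    by (intro L2_set_mono) (simp_all add: matrix_vector_mul_component Cauchy_Schwarz_ineq2)
  also have "\<dots> = norm A * norm x"
    by (simp add: norm_vec_def[of A] L2_set_left_distrib)
  finally show "norm (A *v x) \<le> norm A * norm x" .
qed

lemma frobenius_transpose:
  fixes A :: "real^'n^'m"
  shows "norm (transpose A) = norm A"
  by (simp add: norm_eq_sqrt_inner inner_vec_def transpose_def)
    (rule sum.swap)

lemma spectral_mult: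
  fixes A :: "real^'n^'m" and B :: "real^'p^'n"
  shows "onorm ((*v) (A ** B)) \<le> onorm ((*v) A) * onorm ((*v) B)"
  using onorm_compose[of "(*v) A" "(*v) B"]
  by (simp add: o_def matrix_vector_mul_assoc matrix_vector_mul_bounded_linear)

text \<open>\<open>A\<close> stretches each column of \<open>B\<close> by at most its operator norm.
  The transposes are there because \<open>norm\<close> groups the entries by rows.\<close>

lemma frobenius_mult_spectral:
  fixes A :: "real^'n^'m" and B :: "real^'p^'n"
  shows "norm (A ** B) \<le> onorm ((*v) A) * norm B"
proof -
  have col: "transpose (A ** B) $ j = A *v (transpose B $ j)" for j
    by (simp add: vec_eq_iff transpose_def matrix_matrix_mult_def matrix_vector_mult_def)
  have "norm (transpose (A ** B)) \<le> L2_set (\<lambda>j. onorm ((*v) A) * norm (transpose B $ j)) UNIV"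
    unfolding norm_vec_def[of "transpose (A ** B)"] col
    by (intro L2_set_mono onorm matrix_vector_mul_bounded_linear) simp
  also have "\<dots> = onorm ((*v) A) * norm (transpose B)"
    by (simp add: norm_vec_def[of "transpose B"] L2_set_right_distrib onorm_pos_le
        matrix_vector_mul_bounded_linear)
  finally show ?thesis
    by (simp add: frobenius_transpose)
qed

lemma mnorm_mult:
  fixes A :: "real^'n^'m" and B :: "real^'p^'n"
  shows "mnorm \<nu> (A ** B) \<le> mnorm \<nu> A * mnorm \<nu> B"
proof (cases \<nu>)
  case Spectral
  then show ?thesis by (simp add: spectral_mult)
next
  case Frobenius
  have "norm (A ** B) \<le> norm A * norm B"
    using frobenius_mult_spectral[of A B] onorm_le_frobenius[of A]
    by (meson mult_right_mono norm_ge_zero order_trans)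
  then show ?thesis by (simp add: Frobenius)
qed

lemma mnorm_mult3:
  fixes A :: "real^'n^'m" and B :: "real^'p^'n" and C :: "real^'q^'p"
  shows "mnorm \<nu> (A ** B ** C) \<le> mnorm \<nu> A * mnorm \<nu> B * mnorm \<nu> C"
  using mnorm_mult[of \<nu> "A ** B" C] mnorm_mult[of \<nu> A B] mnorm_nonneg[of \<nu> C]
  by (meson mult_right_mono order_trans)

lemma mnorm_diff:
  fixes A B :: "real^'n^'m"
  shows "mnorm \<nu> (A - B) \<le> mnorm \<nu> A + mnorm \<nu> B"
proof (cases \<nu>)
  case Spectral
  have "onorm (\<lambda>x. A *v x + - (B *v x)) \<le> onorm ((*v) A) + onorm (\<lambda>x. - (B *v x))"
    by (intro onorm_triangle bounded_linear_minus matrix_vector_mul_bounded_linear)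
  then show ?thesis
    by (simp add: Spectral onorm_neg matrix_vector_mult_diff_rdistrib)
next
  case Frobenius
  then show ?thesis by (simp add: norm_triangle_ineq4)
qed

lemma mnorm_Spectral_le_Frobenius: "mnorm Spectral A \<le> mnorm Frobenius A"
  by (simp add: onorm_le_frobenius)

text \<open>The Frobenius norm of the identity is the square root of \<open>CARD('m)\<close>, so the
  bound of f by 1 plus the product can fail when f is a Frobenius norm. The Frobenius case therefore
  appears in two forms: with the spectral norm of \<open>P\<close> as the factor, which keeps the 1,
  and with the norm of the identity in place of the 1.\<close>

theorem theorem6p5:
  fixes M :: "real^'n^'m" and F :: "real^'m^'k" and H :: "real^'l^'n"
    and U :: "real^'l^'m" and V :: "real^'n^'l"
    and \<kappa> :: mat_norm_kind and \<epsilon> :: real and r :: nat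
  assumes "0 \<le> \<epsilon>"
    and "lra_output \<kappa> \<epsilon> r M F H U V"
    and "CARD('k) \<le> CARD('m)" and "CARD('l) \<le> CARD('k)" and "CARD('l) = rank U"
  shows "let P = mat 1 - U ** pinv (F ** U) ** F;
             E = M - U ** pinv U ** M
         in M - U ** V = P ** E
          \<and> (\<forall>\<nu>. mnorm \<nu> (M - U ** V) \<le> mnorm \<nu> P * mnorm \<nu> E)
          \<and> mnorm Spectral P
              \<le> 1 + mnorm Spectral U * mnorm Spectral (pinv (F ** U)) * mnorm Spectral F
          \<and> mnorm Frobenius (M - U ** V) \<le> mnorm Spectral P * mnorm Frobenius E
          \<and> mnorm Spectral P
              \<le> 1 + mnorm Frobenius U * mnorm Frobenius (pinv (F ** U)) * mnorm Frobenius F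
          \<and> mnorm Frobenius P
              \<le> mnorm Frobenius (mat 1 :: real^'m^'m)
                + mnorm Frobenius U * mnorm Frobenius (pinv (F ** U)) * mnorm Frobenius F"
proof -
  define G where "G = pinv (F ** U)"
  define P where "P = mat 1 - U ** G ** F"
  define E where "E = M - U ** pinv U ** M"
  have V: "V = G ** (F ** M)" and r: "r \<le> num_rank \<kappa> \<epsilon> (F ** U)" "rank U = r"
    using assms(2) by (simp_all add: lra_output_def G_def)
  \<comment> \<open>The passed test on \<open>F ** U\<close> and its number of columns squeeze its
    rank to \<open>CARD('l)\<close>.\<close>
  have "CARD('l) \<le> rank (F ** U)"
    using r num_rank_le_rank[OF assms(1), of \<kappa> "F ** U"] assms(5) by simp
  moreover have "rank (F ** U) \<le> CARD('l)"
    using rank_bound[of "F ** U"] by simp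
  ultimately have "inj ((*v) (F ** U))"
    by (simp only: full_rank_injective[symmetric])
  then have GFU: "G ** (F ** U) = mat 1"
    unfolding G_def by (rule pinv_left_inverse)
  have "U ** G ** F ** U = U"
    using GFU by (simp add: matrix_mul_assoc[symmetric])
  then have "P ** U = 0"
    by (simp add: P_def matrix_diff_rdistrib)
  then have "P ** (U ** pinv U ** M) = 0"
    by (simp add: matrix_mul_assoc)
  then have "P ** E = P ** M"
    by (simp add: E_def matrix_diff_ldistrib)
  also have "\<dots> = M - U ** V"
    by (simp add: P_def V matrix_diff_rdistrib matrix_mul_assoc)
  finally have eq: "M - U ** V = P ** E" ..
  \<comment> \<open>The norm of the identity stays symbolic here, since only the spectral case
    bounds it by 1.\<close>
  have P_le: "mnorm \<nu> P \<le> mnorm \<nu> (mat 1 :: real^'m^'m) + mnorm \<nu> U * mnorm \<nu> G * mnorm \<nu> F" for \<nu>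
    unfolding P_def
    using mnorm_diff[of \<nu> "mat 1" "U ** G ** F"] mnorm_mult3[of \<nu> U G F] by linarith
  have "mnorm Spectral (mat 1 :: real^'m^'m) \<le> 1"
    by (simp add: onorm_id_le)
  then have P_spec: "mnorm Spectral P \<le> 1 + mnorm Spectral U * mnorm Spectral G * mnorm Spectral F"
    using P_le[of Spectral] by linarith
  also have "\<dots> \<le> 1 + mnorm Frobenius U * mnorm Frobenius G * mnorm Frobenius F"
    by (intro add_left_mono mult_mono mnorm_Spectral_le_Frobenius mnorm_nonneg mult_nonneg_nonneg)
  finally have P_frob: "mnorm Spectral P \<le> 1 + mnorm Frobenius U * mnorm Frobenius G * mnorm Frobenius F" .
  have "mnorm Frobenius (P ** E) \<le> mnorm Spectral P * mnorm Frobenius E"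
    by (simp add: frobenius_mult_spectral)
  then show ?thesis
    unfolding Let_def G_def[symmetric] P_def[symmetric] E_def[symmetric] eq
    by (intro conjI allI refl mnorm_mult P_spec P_frob P_le[of Frobenius])
qed

end
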